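(* Let $\Gamma=\mathbb{Z}/k_1\mathbb{Z}\times\dots\times\mathbb{Z}/k_l\mathbb{Z}$ be a finite Abelian group, let $G$ be a finite simple graph with an action $\theta:\Gamma\to\mathrm{Aut}(G)$ that is free on $V(G)$ and on $E(G)$, let $\tau:\Gamma\to O(\mathbb{R}^d)$ be a homomorphism, let $(G,p)$ be a $\Gamma$-symmetric framework in $\mathbb{R}^d$ with respect to $\theta$ and $\tau$, and let $(H,\psi)$ be the quotient $\Gamma$-gain graph of $G$, with $\tilde p:V(H)\to\mathbb{R}^d$ the quotient of $p$. Then for each $\boldsymbol{j}\in\Gamma$, $$\operatorname{rank}\widetilde R_{\boldsymbol j}(G,p)=\operatorname{rank} O_{\boldsymbol j}(H,\psi,\tilde p).$$
   Context: A framework $(G,p)$ in $\mathbb{R}^d$ is a finite simple graph $G$ with a map $p:V(G)\to\mathbb{R}^d$ such that $p(u)\ne p(v)$ for all $\{u,v\}\in E(G)$. Its rigidity matrix $R(G,p)$ is the $|E(G)|\times d|V(G)|$ matrix whose row for $\{u,v\}$ has $(p(u)-p(v))^\top$ in the $d$ columns of $u$, $(p(v)-p(u))^\top$ in the $d$ columns of $v$, and $0$ elsewhere. It is regarded here as a linear map $(\mathbb{C}^d)^{V(G)}\to\mathbb{C}^{E(G)}$. An action of $\Gamma$ on $G$ is a homomorphism $\theta:\Gamma\to\mathrm{Aut}(G)$; write $\gamma v=\theta(\gamma)(v)$. It is free on $V(G)$ (resp. $E(G)$) if no non-identity element fixes a vertex (resp. an edge, as an unordered pair). $(G,p)$ is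 $\Gamma$-symmetric with respect to $\theta,\tau$ if $\tau(\gamma)p(v)=p(\gamma v)$ for all $\gamma\in\Gamma$, $v\in V(G)$. Quotient gain graph: choose one representative vertex in each vertex orbit. $V(H)$ is the set of vertex orbits and $E(H)$ the set of edge orbits. An edge orbit joining the orbits of representatives $u$ and $v$ has the form $\{\{\gamma u,\gamma h v\}:\gamma\in\Gamma\}$ for some $h\in\Gamma$ (unique once the orbit is oriented from the orbit of $u$ to that of $v$); it is a directed edge (possibly a loop) of $H$ from the orbit of $u$ to that of $v$ with gain $\psi_{\tilde e}=h$. The quotient $\tilde p$ of $p$ assigns to each vertex orbit the point $p(v)$ of its representative $v$. Irreducible representations: for $\boldsymbol j=(j_1,\dots,j_l)\in\Gamma$, $\rho_{\boldsymbol j}:\Gamma\to\mathbb{C}\setminus\{0\}$ is $\rho_{\boldsymbol j}(i_1,\dots,i_l)=\omega_1^{i_1j_1}\cdots\omega_l^{i_lj_l}$ with $\omega_t=e^{2\pi\sqrt{-1}/k_t}$. Block $\widetilde R_{\boldsymbol j}(G,p)$: let $J_{\boldsymbol j}^{\rm mo}=\{m\in(\mathbb{C}^d)^{V(G)}: m(\gamma v)=\overline{\rho_{\boldsymbol j}(\gamma)}\,\tau(\gamma)m(v)\ \forall\gamma\in\Gamma, v\in V(G)\}$ and $I_{\boldsymbol j}^{\rm st}=\{w\in\mathbb{C}^{E(G)}: w(\gamma e)=\overline{\rho_{\boldsymbol j}(\gamma)}\,w(e)\ \forall\gamma\in\Gamma,e\in E(G)\}$. These are the $\rho_{\boldsymbol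 j}$-isotypic subspaces, and $R(G,p)$ maps $J_{\boldsymbol j}^{\rm mo}$ into $I_{\boldsymbol j}^{\rm st}$. $\widetilde R_{\boldsymbol j}(G,p)$ is (a matrix of) the restricted map $J_{\boldsymbol j}^{\rm mo}\to I_{\boldsymbol j}^{\rm st}$. Orbit rigidity matrix $O_{\boldsymbol j}(H,\psi,\tilde p)$: the $|E(H)|\times d|V(H)|$ complex matrix whose row for $\tilde e=(\tilde u,\tilde v)\in E(H)$ has $(\tilde p(\tilde u)-\tau(\psi_{\tilde e})\tilde p(\tilde v))^\top$ in the $d$ columns of $\tilde u$, $\rho_{\boldsymbol j}(\psi_{\tilde e})(\tilde p(\tilde v)-\tau(\psi_{\tilde e})^{-1}\tilde p(\tilde u))^\top$ in the $d$ columns of $\tilde v$, and $0$ elsewhere; if $\tilde e$ is a loop at $\tilde v$, the entries in the columns of $\tilde v$ are the sum of these two vectors. *)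

theory Defs
  imports
    "HOL-Analysis.Analysis"
    "HOL-Algebra.Elementary_Groups"
    "HOL-Algebra.Product_Groups"
    "HOL-Algebra.Group_Action"
    "HOL-Algebra.Bij"
    "HOL-Library.Function_Algebras"
begin

section \<open>Rank of complex matrices and maps with set-indexed coordinates\<close>

text \<open>Rows, columns, vertices and edges are indexed by finite sets rather than finite types.
  A vector with coordinates in a set is a function that vanishes outside of that set,
  and these functions live in the complex vector space of all functions.\<close>

definition scale_fun :: "complex \<Rightarrow> ('a \<Rightarrow> complex) \<Rightarrow> 'a \<Rightarrow> complex"
  where "scale_fun c f = (\<lambda>x. c * f x)"

global_interpretation cfun: vector_space scale_fun
  by standard (auto simp: scale_fun_def fun_eq_iff algebra_simps)

definition map_rank :: "'b set \<Rightarrow> ('b \<Rightarrow> 'a \<Rightarrow> complex) \<Rightarrow> nat"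
  where "map_rank S f = cfun.dim (f ` S)"

definition matrix_col :: "'r set \<Rightarrow> ('r \<Rightarrow> 'c \<Rightarrow> complex) \<Rightarrow> 'c \<Rightarrow> 'r \<Rightarrow> complex"
  where "matrix_col I A c = (\<lambda>r. if r \<in> I then A r c else 0)"

definition matrix_rank :: "'r set \<Rightarrow> 'c set \<Rightarrow> ('r \<Rightarrow> 'c \<Rightarrow> complex) \<Rightarrow> nat"
  where "matrix_rank I J A = cfun.dim (matrix_col I A ` J)"


section \<open>Groups, characters and actions\<close>

definition cyclic_product :: "nat \<Rightarrow> (nat \<Rightarrow> nat) \<Rightarrow> (nat \<Rightarrow> int) monoid"
  where "cyclic_product l k = product_group {1..l} (\<lambda>t. integer_mod_group (k t))"

definition character :: "nat \<Rightarrow> (nat \<Rightarrow> nat) \<Rightarrow> (nat \<Rightarrow> int) \<Rightarrow> (nat \<Rightarrow> int) \<Rightarrow> complex"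
  where "character l k j i = (\<Prod>t = 1..l. exp (2 * of_real pi * \<i> / of_nat (k t)) powi (i t * j t))"

definition orthogonal_grp :: "(real ^ 'd ^ 'd) monoid"
  where "orthogonal_grp =
    \<lparr>carrier = {A. orthogonal_matrix A}, monoid.mult = (\<lambda>A B. A ** B), one = mat 1\<rparr>"

definition simple_graph :: "'v set \<Rightarrow> 'v set set \<Rightarrow> bool"
  where "simple_graph V E \<longleftrightarrow> finite V \<and> (\<forall>e\<in>E. e \<subseteq> V \<and> card e = 2)"

definition graph_aut_group :: "'v set \<Rightarrow> 'v set set \<Rightarrow> ('v \<Rightarrow> 'v) monoid"
  where "graph_aut_group V E =
    BijGroup V \<lparr>carrier := {f \<in> Bij V. \<forall>u\<in>V. \<forall>v\<in>V. {u, v} \<in> E \<longleftrightarrow> {f u, f v} \<in> E}\<rparr>"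

definition free_action :: "('g, 'm) monoid_scheme \<Rightarrow> 'a set \<Rightarrow> ('g \<Rightarrow> 'a \<Rightarrow> 'a) \<Rightarrow> bool"
  where "free_action \<Gamma> X \<phi> \<longleftrightarrow> (\<forall>\<gamma> \<in> carrier \<Gamma>. \<gamma> \<noteq> \<one>\<^bsub>\<Gamma>\<^esub> \<longrightarrow> (\<forall>x\<in>X. \<phi> \<gamma> x \<noteq> x))"

definition edge_action :: "('g \<Rightarrow> 'v \<Rightarrow> 'v) \<Rightarrow> 'g \<Rightarrow> 'v set \<Rightarrow> 'v set"
  where "edge_action \<theta> \<gamma> e = \<theta> \<gamma> ` e"


section \<open>Symmetric frameworks and the blocks of the rigidity matrix\<close>

definition framework :: "'v set \<Rightarrow> 'v set set \<Rightarrow> ('v \<Rightarrow> real ^ 'd) \<Rightarrow> bool"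
  where "framework V E p \<longleftrightarrow> simple_graph V E \<and> (\<forall>u v. {u, v} \<in> E \<longrightarrow> p u \<noteq> p v)"

definition symmetric_framework ::
  "('g, 'm) monoid_scheme \<Rightarrow> 'v set \<Rightarrow> 'v set set \<Rightarrow> ('g \<Rightarrow> 'v \<Rightarrow> 'v) \<Rightarrow> ('g \<Rightarrow> real ^ 'd ^ 'd)
    \<Rightarrow> ('v \<Rightarrow> real ^ 'd) \<Rightarrow> bool"
  where "symmetric_framework \<Gamma> V E \<theta> \<tau> p \<longleftrightarrow>
    framework V E p \<and> (\<forall>\<gamma> \<in> carrier \<Gamma>. \<forall>v\<in>V. \<tau> \<gamma> *v p v = p (\<theta> \<gamma> v))"

definition other_end :: "'v set \<Rightarrow> 'v \<Rightarrow> 'v"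
  where "other_end e u = (THE v. e = {u, v})"

definition rigidity_matrix :: "('v \<Rightarrow> real ^ 'd) \<Rightarrow> 'v set \<Rightarrow> 'v \<times> 'd \<Rightarrow> real"
  where "rigidity_matrix p e = (\<lambda>(u, a). if u \<in> e then (p u - p (other_end e u)) $ a else 0)"

definition rigidity_map ::
  "'v set \<Rightarrow> 'v set set \<Rightarrow> ('v \<Rightarrow> real ^ 'd) \<Rightarrow> ('v \<Rightarrow> complex ^ 'd) \<Rightarrow> 'v set \<Rightarrow> complex"
  where "rigidity_map V E p m = (\<lambda>e. if e \<in> E
    then \<Sum>(u, a) \<in> V \<times> UNIV. of_real (rigidity_matrix p e (u, a)) * m u $ a else 0)"

definition isotypic_motions ::
  "('g, 'm) monoid_scheme \<Rightarrow> 'v set \<Rightarrow> ('g \<Rightarrow> 'v \<Rightarrow> 'v) \<Rightarrow> ('g \<Rightarrow> real ^ 'd ^ 'd)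
    \<Rightarrow> ('g \<Rightarrow> complex) \<Rightarrow> ('v \<Rightarrow> complex ^ 'd) set"
  where "isotypic_motions \<Gamma> V \<theta> \<tau> \<rho> =
    {m. (\<forall>v. v \<notin> V \<longrightarrow> m v = 0) \<and>
        (\<forall>\<gamma> \<in> carrier \<Gamma>. \<forall>v\<in>V.
          m (\<theta> \<gamma> v) = cnj (\<rho> \<gamma>) *s (map_matrix of_real (\<tau> \<gamma>) *v m v))}"

definition isotypic_stresses ::
  "('g, 'm) monoid_scheme \<Rightarrow> 'v set set \<Rightarrow> ('g \<Rightarrow> 'v \<Rightarrow> 'v) \<Rightarrow> ('g \<Rightarrow> complex)
    \<Rightarrow> ('v set \<Rightarrow> complex) set"
  where "isotypic_stresses \<Gamma> E \<theta> \<rho> =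
    {w. (\<forall>e. e \<notin> E \<longrightarrow> w e = 0) \<and>
        (\<forall>\<gamma> \<in> carrier \<Gamma>. \<forall>e\<in>E. w (edge_action \<theta> \<gamma> e) = cnj (\<rho> \<gamma>) * w e)}"

definition block_rigidity_map ::
  "('g, 'm) monoid_scheme \<Rightarrow> 'v set \<Rightarrow> 'v set set \<Rightarrow> ('g \<Rightarrow> 'v \<Rightarrow> 'v) \<Rightarrow> ('g \<Rightarrow> real ^ 'd ^ 'd)
    \<Rightarrow> ('g \<Rightarrow> complex) \<Rightarrow> ('v \<Rightarrow> real ^ 'd) \<Rightarrow> ('v \<Rightarrow> complex ^ 'd) \<Rightarrow> 'v set \<Rightarrow> complex"
  where "block_rigidity_map \<Gamma> V E \<theta> \<tau> \<rho> p =
    restrict (rigidity_map V E p) (isotypic_motions \<Gamma> V \<theta> \<tau> \<rho>)"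


section \<open>Quotient gain graphs and orbit rigidity matrices\<close>

definition vertex_orbits ::
  "('g, 'm) monoid_scheme \<Rightarrow> 'v set \<Rightarrow> ('g \<Rightarrow> 'v \<Rightarrow> 'v) \<Rightarrow> 'v set set"
  where "vertex_orbits \<Gamma> V \<theta> = orbits \<Gamma> V \<theta>"

definition edge_orbits ::
  "('g, 'm) monoid_scheme \<Rightarrow> 'v set set \<Rightarrow> ('g \<Rightarrow> 'v \<Rightarrow> 'v) \<Rightarrow> 'v set set set"
  where "edge_orbits \<Gamma> E \<theta> = orbits \<Gamma> E (edge_action \<theta>)"

text \<open>The quotient depends on the representatives \<open>rep\<close> and on an orientation of every edge orbit.
  The predicate holds for every such choice; in particular, for a loop both
  orientations (gains inverse to one another) are allowed.\<close>

definition quotient_gain_graph ::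
  "('g, 'm) monoid_scheme \<Rightarrow> 'v set \<Rightarrow> 'v set set \<Rightarrow> ('g \<Rightarrow> 'v \<Rightarrow> 'v) \<Rightarrow> ('v set \<Rightarrow> 'v)
    \<Rightarrow> ('v set set \<Rightarrow> 'v set) \<Rightarrow> ('v set set \<Rightarrow> 'v set) \<Rightarrow> ('v set set \<Rightarrow> 'g) \<Rightarrow> bool"
  where "quotient_gain_graph \<Gamma> V E \<theta> rep src tgt \<psi> \<longleftrightarrow>
    (\<forall>X \<in> vertex_orbits \<Gamma> V \<theta>. rep X \<in> X) \<and>
    (\<forall>e \<in> edge_orbits \<Gamma> E \<theta>.
        src e \<in> vertex_orbits \<Gamma> V \<theta> \<and> tgt e \<in> vertex_orbits \<Gamma> V \<theta> \<and> \<psi> e \<in> carrier \<Gamma> \<and>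
        e = {{\<theta> \<gamma> (rep (src e)), \<theta> (\<gamma> \<otimes>\<^bsub>\<Gamma>\<^esub> \<psi> e) (rep (tgt e))} | \<gamma>. \<gamma> \<in> carrier \<Gamma>})"

definition quotient_points :: "('v set \<Rightarrow> 'v) \<Rightarrow> ('v \<Rightarrow> real ^ 'd) \<Rightarrow> 'v set \<Rightarrow> real ^ 'd"
  where "quotient_points rep p X = p (rep X)"

text \<open>For a loop both conditions hold in the same column, so that the two entries are added.\<close>

definition orbit_rigidity_matrix ::
  "('g \<Rightarrow> real ^ 'd ^ 'd) \<Rightarrow> ('g \<Rightarrow> complex) \<Rightarrow> ('e \<Rightarrow> 'x) \<Rightarrow> ('e \<Rightarrow> 'x) \<Rightarrow> ('e \<Rightarrow> 'g)
    \<Rightarrow> ('x \<Rightarrow> real ^ 'd) \<Rightarrow> 'e \<Rightarrow> 'x \<times> 'd \<Rightarrow> complex"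
  where "orbit_rigidity_matrix \<tau> \<rho> src tgt \<psi> q e = (\<lambda>(X, a).
    (if X = src e then of_real ((q (src e) - \<tau> (\<psi> e) *v q (tgt e)) $ a) else 0) +
    (if X = tgt e
     then \<rho> (\<psi> e) * of_real ((q (tgt e) - matrix_inv (\<tau> (\<psi> e)) *v q (src e)) $ a) else 0))"


section \<open>The rigidity map respects the isotypic subspaces\<close>

lemma other_end_eq: "u \<noteq> v \<Longrightarrow> other_end {u, v} u = v"
  unfolding other_end_def by (rule the_equality) (auto simp: doubleton_eq_iff)

lemma orthogonal_dot_complex:
  fixes A :: "real ^ 'd ^ 'd"
  assumes "orthogonal_matrix A"
  shows "(\<Sum>a\<in>UNIV. of_real ((A *v x) $ a) * (map_matrix of_real A *v y) $ a)
       = (\<Sum>a\<in>UNIV. complex_of_real (x $ a) * y $ a)"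
proof -
  have tr: "(\<Sum>a\<in>UNIV. A $ a $ b * A $ a $ c) = (if b = c then 1 else 0)" for b c
  proof -
    have "(transpose A ** A) $ b $ c = (mat 1 :: real ^ 'd ^ 'd) $ b $ c"
      using assms by (simp add: orthogonal_matrix)
    then show ?thesis by (simp add: matrix_matrix_mult_def transpose_def mat_def)
  qed
  have "(\<Sum>a\<in>UNIV. of_real ((A *v x) $ a) * (map_matrix of_real A *v y) $ a)
      = (\<Sum>a\<in>UNIV. \<Sum>b\<in>UNIV. \<Sum>c\<in>UNIV.
           of_real (A $ a $ b * A $ a $ c) * (complex_of_real (x $ b) * y $ c))"
    unfolding matrix_vector_mult_def vec_lambda_beta nth_map_matrix of_real_sum sum_product of_real_mult
    by (intro sum.cong refl) (simp add: mult_ac)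
  also have "\<dots> = (\<Sum>b\<in>UNIV. \<Sum>a\<in>UNIV. \<Sum>c\<in>UNIV.
           of_real (A $ a $ b * A $ a $ c) * (complex_of_real (x $ b) * y $ c))"
    by (rule sum.swap)
  also have "\<dots> = (\<Sum>b\<in>UNIV. \<Sum>c\<in>UNIV. \<Sum>a\<in>UNIV.
           of_real (A $ a $ b * A $ a $ c) * (complex_of_real (x $ b) * y $ c))"
    by (rule sum.cong[OF refl], rule sum.swap)
  also have "\<dots> = (\<Sum>b\<in>UNIV. \<Sum>c\<in>UNIV.
           of_real (\<Sum>a\<in>UNIV. A $ a $ b * A $ a $ c) * (complex_of_real (x $ b) * y $ c))"
    by (simp only: of_real_sum sum_distrib_right)
  also have "\<dots> = (\<Sum>b\<in>UNIV. \<Sum>c\<in>UNIV. if b = c then complex_of_real (x $ b) * y $ c else 0)"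
    by (intro sum.cong refl) (simp add: tr)
  also have "\<dots> = (\<Sum>b\<in>UNIV. complex_of_real (x $ b) * y $ b)"
    by simp
  finally show ?thesis .
qed

lemma rigidity_map_isotypic:
  fixes p :: "'v \<Rightarrow> real ^ 'd"
  assumes th: "\<theta> \<in> hom \<Gamma> (graph_aut_group V E)"
    and ta: "\<tau> \<in> hom \<Gamma> orthogonal_grp"
    and fw: "symmetric_framework \<Gamma> V E \<theta> \<tau> p"
    and m: "m \<in> isotypic_motions \<Gamma> V \<theta> \<tau> \<rho>"
  shows "rigidity_map V E p m \<in> isotypic_stresses \<Gamma> E \<theta> \<rho>"
proof -
  have "rigidity_map V E p m (edge_action \<theta> g e) = cnj (\<rho> g) * rigidity_map V E p m e"
    if g: "g \<in> carrier \<Gamma>" and e: "e \<in> E" for g e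
  proof -
    have sg: "simple_graph V E" and sym: "\<And>v. v \<in> V \<Longrightarrow> p (\<theta> g v) = \<tau> g *v p v"
      using fw g by (auto simp: symmetric_framework_def framework_def)
    have "\<theta> g \<in> carrier (graph_aut_group V E)"
      using th g unfolding hom_def by blast
    then have bij: "bij_betw (\<theta> g) V V"
      and aut: "\<And>u v. u \<in> V \<Longrightarrow> v \<in> V \<Longrightarrow> {u, v} \<in> E \<longleftrightarrow> {\<theta> g u, \<theta> g v} \<in> E"
      by (auto simp: graph_aut_group_def Bij_def)
    have inj: "inj_on (\<theta> g) V" using bij by (simp add: bij_betw_def)
    have "\<tau> g \<in> carrier orthogonal_grp"
      using ta g unfolding hom_def by blast
    then have orth: "orthogonal_matrix (\<tau> g)" by (simp add: orthogonal_grp_def)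
    obtain u v where uv: "e = {u, v}" "u \<noteq> v" "u \<in> V" "v \<in> V"
      using sg e by (fastforce simp: simple_graph_def card_2_iff)
    have ne: "\<theta> g u \<noteq> \<theta> g v" using inj uv by (auto dest: inj_onD)
    have ge: "edge_action \<theta> g e = {\<theta> g u, \<theta> g v}" by (simp add: edge_action_def uv)
    have geE: "{\<theta> g u, \<theta> g v} \<in> E" using aut e uv by simp
    have finV: "finite V" using sg by (simp add: simple_graph_def)
    have row: "(\<Sum>(w, a) \<in> V \<times> UNIV. of_real (rigidity_matrix p {x, y} (w, a)) * m w $ a)
        = (\<Sum>a\<in>UNIV. of_real ((p x - p y) $ a) * m x $ a)
        + (\<Sum>a\<in>UNIV. of_real ((p y - p x) $ a) * m y $ a)"
      if xy: "x \<noteq> y" "x \<in> V" "y \<in> V" for x y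
    proof -
      have oy: "other_end {x, y} y = x"
        using xy other_end_eq[of y x] by (simp add: insert_commute)
      have "(\<Sum>(w, a) \<in> V \<times> UNIV. of_real (rigidity_matrix p {x, y} (w, a)) * m w $ a)
          = (\<Sum>w\<in>V. \<Sum>a\<in>UNIV. of_real (rigidity_matrix p {x, y} (w, a)) * m w $ a)"
        by (simp add: sum.cartesian_product)
      also have "\<dots> = (\<Sum>w\<in>{x, y}. \<Sum>a\<in>UNIV. of_real (rigidity_matrix p {x, y} (w, a)) * m w $ a)"
        using finV xy by (intro sum.mono_neutral_right) (auto simp: rigidity_matrix_def)
      also have "\<dots> = (\<Sum>a\<in>UNIV. of_real ((p x - p y) $ a) * m x $ a)
        + (\<Sum>a\<in>UNIV. of_real ((p y - p x) $ a) * m y $ a)"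
        using xy by (simp add: rigidity_matrix_def other_end_eq oy)
      finally show ?thesis .
    qed
    have inV: "\<theta> g u \<in> V" "\<theta> g v \<in> V" using bij uv by (auto simp: bij_betw_def)
    have half: "(\<Sum>a\<in>UNIV. of_real ((p (\<theta> g x) - p (\<theta> g y)) $ a) * m (\<theta> g x) $ a)
        = cnj (\<rho> g) * (\<Sum>a\<in>UNIV. of_real ((p x - p y) $ a) * m x $ a)"
      if "x \<in> V" "y \<in> V" for x y
    proof -
      have mx: "m (\<theta> g x) = cnj (\<rho> g) *s (map_matrix of_real (\<tau> g) *v m x)"
        using m g that by (auto simp: isotypic_motions_def)
      have px: "p (\<theta> g x) - p (\<theta> g y) = \<tau> g *v (p x - p y)"
        using that by (simp add: sym matrix_vector_mult_diff_distrib)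
      have "(\<Sum>a\<in>UNIV. of_real ((p (\<theta> g x) - p (\<theta> g y)) $ a) * m (\<theta> g x) $ a)
          = cnj (\<rho> g) * (\<Sum>a\<in>UNIV. of_real ((\<tau> g *v (p x - p y)) $ a)
              * (map_matrix of_real (\<tau> g) *v m x) $ a)"
        unfolding mx px vector_smult_component sum_distrib_left
        by (intro sum.cong refl) (simp only: mult_ac)
      then show ?thesis
        by (simp only: orthogonal_dot_complex[OF orth])
    qed
    have "rigidity_map V E p m (edge_action \<theta> g e)
        = (\<Sum>(w, a) \<in> V \<times> UNIV. of_real (rigidity_matrix p {\<theta> g u, \<theta> g v} (w, a)) * m w $ a)"
      using geE by (simp only: rigidity_map_def ge if_True)
    also have "\<dots> = cnj (\<rho> g) * (\<Sum>(w, a) \<in> V \<times> UNIV. of_real (rigidity_matrix p {u, v} (w, a)) * m w $ a)"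
      by (simp only: row[OF ne inV] row[OF uv(2-4)] half[OF uv(3,4)] half[OF uv(4,3)] distrib_left)
    also have "\<dots> = cnj (\<rho> g) * rigidity_map V E p m e"
      using e by (simp only: rigidity_map_def uv(1) if_True)
    finally show ?thesis .
  qed
  then show ?thesis
    by (simp add: isotypic_stresses_def rigidity_map_def)
qed

end

theory Submission
  imports Defs
begin

text \<open>A motion \<open>m\<close> in the isotypic space is determined by its values on the representatives, which by
  freeness on the vertices are arbitrary, and an isotypic stress is determined by its values on the
  edges \<open>{u, h v}\<close>, one for each edge orbit. In these coordinates \<open>m(h v) = cnj (\<rho> h) \<tau>(h) m(v)\<close>
  turns the rigidity map into the entrywise conjugate of the orbit matrix, because the points are
  real. Conjugation does not change ranks; the two images are conjugate-linear
  images of one another.\<close>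

section \<open>Spans and dimensions under semilinear maps\<close>

lemma image_span_semilinear:
  assumes add: "\<And>x y. f (x + y) = f x + f y"
    and scale: "\<And>c x. f (scale_fun c x) = scale_fun (\<sigma> c) (f x)"
  shows "f ` cfun.span B \<subseteq> cfun.span (f ` B)"
proof -
  have f0: "f 0 = 0" using add[of 0 0] by simp
  have "f x \<in> cfun.span (f ` B)" if "x \<in> cfun.span B" for x
    using that
  proof (induction rule: cfun.span_induct_alt)
    case base
    show ?case unfolding f0 by (rule cfun.span_zero)
  next
    case (step c x y)
    then show ?case
      unfolding add scale by (intro cfun.span_add[OF cfun.span_scale[OF cfun.span_base]] imageI)
  qed
  then show ?thesis by blast
qed

lemma dim_semilinear_image_le:
  assumes add: "\<And>x y. f (x + y) = f x + f y"
    and scale: "\<And>c x. f (scale_fun c x) = scale_fun (\<sigma> c) (f x)"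
    and S: "S \<subseteq> cfun.span W" "finite W"
  shows "cfun.dim (f ` S) \<le> cfun.dim S"
proof -
  obtain B where B: "B \<subseteq> S" "cfun.independent B" "S \<subseteq> cfun.span B" "card B = cfun.dim S"
    using cfun.basis_exists by blast
  have fin: "finite B"
    using cfun.independent_span_bound[OF S(2) B(2)] B(1) S(1) by blast
  have "f ` S \<subseteq> cfun.span (f ` B)"
    using B(3) image_span_semilinear[of f \<sigma> B, OF add scale] by blast
  then have "cfun.dim (f ` S) \<le> card (f ` B)"
    using fin by (intro cfun.dim_le_card) auto
  also have "\<dots> \<le> card B" using fin by (rule card_image_le)
  finally show ?thesis by (simp add: B(4))
qed

section \<open>Column spaces\<close>

lemma sum_scale_matrix_col:
  "(\<Sum>c\<in>J. scale_fun (x c) (matrix_col I A c)) = (\<lambda>r. if r \<in> I then \<Sum>c\<in>J. x c * A r c else 0)"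
  by (induct J rule: infinite_finite_induct) (auto simp: scale_fun_def matrix_col_def fun_eq_iff)

text \<open>Identifies the column space with the set of all products of the matrix with a vector
  \<open>x\<close>. The range is a subspace, and unit vectors show that it contains the
  columns.\<close>

lemma span_matrix_col:
  assumes "finite J"
  shows "cfun.span (matrix_col I A ` J) = range (\<lambda>x r. if r \<in> I then \<Sum>c\<in>J. x c * A r c else 0)"
proof
  let ?f = "\<lambda>x r. if r \<in> I then \<Sum>c\<in>J. x c * A r c else 0"
  show "range ?f \<subseteq> cfun.span (matrix_col I A ` J)"
    unfolding sum_scale_matrix_col[symmetric]
    by (auto intro!: cfun.span_sum cfun.span_scale intro: cfun.span_base)
  have "matrix_col I A c = ?f (\<lambda>d. if d = c then 1 else 0)" if "c \<in> J" for c
    using that assms by (auto simp: matrix_col_def fun_eq_iff if_distrib[of "\<lambda>x. x * _"] cong: if_cong)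
  then have "matrix_col I A ` J \<subseteq> range ?f"
    by (intro image_subsetI range_eqI)
  moreover have "cfun.subspace (range ?f)"
  proof (rule cfun.subspaceI)
    have "0 = ?f (\<lambda>c. 0)" by (auto simp: fun_eq_iff)
    then show "0 \<in> range ?f" by (intro range_eqI)
  next
    fix y z assume "y \<in> range ?f" "z \<in> range ?f"
    then obtain a b where "y = ?f a" "z = ?f b" by blast
    then have "y + z = ?f (\<lambda>c. a c + b c)"
      by (auto simp: fun_eq_iff sum.distrib distrib_right)
    then show "y + z \<in> range ?f" by (intro range_eqI)
  next
    fix s y assume "y \<in> range ?f"
    then obtain a where "y = ?f a" by blast
    then have "scale_fun s y = ?f (\<lambda>c. s * a c)"
      by (auto simp: fun_eq_iff scale_fun_def sum_distrib_left mult_ac)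
    then show "scale_fun s y \<in> range ?f" by (intro range_eqI)
  qed
  ultimately show "cfun.span (matrix_col I A ` J) \<subseteq> range ?f"
    by (rule cfun.span_minimal)
qed

section \<open>Characters of products of cyclic groups\<close>

lemma root_of_unity_powi_mod:
  assumes "k > 0"
  shows "exp (2 * of_real pi * \<i> / of_nat k) powi ((a + b) mod int k * j)
       = exp (2 * of_real pi * \<i> / of_nat k) powi (a * j) * exp (2 * of_real pi * \<i> / of_nat k) powi (b * j)"
proof -
  let ?w = "exp (2 * of_real pi * \<i> / of_nat k) :: complex"
  have "?w ^ k = exp (of_nat k * (2 * of_real pi * \<i> / of_nat k))"
    by (rule exp_of_nat_mult[symmetric])
  also have "\<dots> = 1" using assms by (simp add: exp_two_pi_i)
  finally have wk: "?w powi int k = 1" by simp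
  have period: "?w powi (int k * n) = 1" for n
    by (simp only: power_int_mult wk power_int_1_left)
  \<comment> \<open>Division with remainder splits off a multiple of \<open>k\<close>, which
    contributes the factor 1 to the power.\<close>
  have "a * j + b * j = (a + b) mod int k * j + int k * ((a + b) div int k * j)"
    by (metis (no_types) add.commute distrib_right mult.assoc mult_div_mod_eq)
  then have "?w powi (a * j + b * j) = ?w powi ((a + b) mod int k * j)"
    by (simp add: power_int_add period)
  then show ?thesis by (simp add: power_int_add)
qed

lemma character_mult:
  assumes "\<forall>t\<in>{1..l}. k t > 0"
  shows "character l k j (a \<otimes>\<^bsub>cyclic_product l k\<^esub> b) = character l k j a * character l k j b"
  using assms
  by (simp add: character_def cyclic_product_def root_of_unity_powi_mod flip: prod.distrib)

lemma character_one: "character l k j \<one>\<^bsub>cyclic_product l k\<^esub> = 1"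
  by (simp add: character_def cyclic_product_def)

lemma group_cyclic_product: "group (cyclic_product l k)"
  by (simp add: cyclic_product_def)

section \<open>Auxiliary facts on actions, matrices and rows of the rigidity matrix\<close>

lemma hom_BijGroup_if_hom_graph_aut_group:
  "\<theta> \<in> hom \<Gamma> (graph_aut_group V E) \<Longrightarrow> \<theta> \<in> hom \<Gamma> (BijGroup V)"
  by (auto simp: hom_def graph_aut_group_def BijGroup_def)

lemma map_matrix_of_real_mult:
  fixes A :: "real ^ 'n ^ 'm" and B :: "real ^ 'k ^ 'n"
  shows "map_matrix complex_of_real (A ** B) = map_matrix of_real A ** map_matrix of_real B"
  by (simp add: vec_eq_iff matrix_matrix_mult_def)

lemma map_matrix_of_real_one: "map_matrix complex_of_real (mat 1) = mat 1"
  by (simp add: vec_eq_iff mat_def)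

lemma orthogonal_matrix_inv_right:
  fixes A :: "real ^ 'd ^ 'd"
  assumes "orthogonal_matrix A"
  shows "A ** matrix_inv A = mat 1"
proof -
  have "\<exists>B. A ** B = mat 1 \<and> B ** A = mat 1"
    using assms by (auto simp: orthogonal_matrix_def)
  then show ?thesis unfolding matrix_inv_def by (rule someI2_ex) simp
qed

text \<open>A row of the rigidity matrix is supported on the columns of its two ends, so the sum
  over \<open>V\<close> collapses to two terms.\<close>

lemma rigidity_map_edge:
  assumes V: "finite V" and xy: "x \<noteq> y" "x \<in> V" "y \<in> V" "{x, y} \<in> E"
  shows "rigidity_map V E p m {x, y}
    = (\<Sum>a\<in>UNIV. of_real ((p x - p y) $ a) * m x $ a)
    + (\<Sum>a\<in>UNIV. of_real ((p y - p x) $ a) * m y $ a)"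
proof -
  have oy: "other_end {x, y} y = x"
    using xy other_end_eq[of y x] by (simp add: insert_commute)
  have "rigidity_map V E p m {x, y}
      = (\<Sum>w\<in>V. \<Sum>a\<in>UNIV. of_real (rigidity_matrix p {x, y} (w, a)) * m w $ a)"
    using xy by (simp add: rigidity_map_def sum.cartesian_product)
  also have "\<dots> = (\<Sum>w\<in>{x, y}. \<Sum>a\<in>UNIV. of_real (rigidity_matrix p {x, y} (w, a)) * m w $ a)"
    using V xy by (intro sum.mono_neutral_right) (auto simp: rigidity_matrix_def)
  also have "\<dots> = (\<Sum>a\<in>UNIV. of_real ((p x - p y) $ a) * m x $ a)
    + (\<Sum>a\<in>UNIV. of_real ((p y - p x) $ a) * m y $ a)"
    using xy by (simp add: rigidity_matrix_def other_end_eq oy)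
  finally show ?thesis .
qed

text \<open>The comparison is carried out for a group \<open>\<Gamma>\<close> and a multiplicative
  \<open>\<rho>\<close>, without reference to roots of unity. The condition \<open>rho_one\<close>
  excludes the zero function; through it an extended motion keeps its prescribed values on the
  representatives.\<close>

locale symmetric_gain_framework = group_action \<Gamma> V \<theta>
  for \<Gamma> (structure) and V :: "'v set" and \<theta> +
  fixes E :: "'v set set" and \<tau> :: "_ \<Rightarrow> real ^ 'd ^ 'd" and p :: "'v \<Rightarrow> real ^ 'd"
    and rep src tgt \<psi> and \<rho> :: "_ \<Rightarrow> complex"
  assumes theta_hom: "\<theta> \<in> hom \<Gamma> (graph_aut_group V E)"
    and free: "free_action \<Gamma> V \<theta>"
    and tau_hom: "\<tau> \<in> hom \<Gamma> orthogonal_grp"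
    and symmetric: "symmetric_framework \<Gamma> V E \<theta> \<tau> p"
    and gain: "quotient_gain_graph \<Gamma> V E \<theta> rep src tgt \<psi>"
    and rho_one: "\<rho> \<one> = 1"
    and rho_mult: "\<lbrakk>g \<in> carrier \<Gamma>; h \<in> carrier \<Gamma>\<rbrakk> \<Longrightarrow> \<rho> (g \<otimes> h) = \<rho> g * \<rho> h"
begin

sublocale group \<Gamma>
  using group_hom by (rule group_hom.axioms(1))

lemma graph: "simple_graph V E"
  using symmetric by (simp add: symmetric_framework_def framework_def)

lemma finite_V: "finite V"
  using graph by (simp add: simple_graph_def)

lemma theta_one: "v \<in> V \<Longrightarrow> \<theta> \<one> v = v"
  using id_eq_one by (metis restrict_apply')

lemma p_theta: "\<lbrakk>g \<in> carrier \<Gamma>; v \<in> V\<rbrakk> \<Longrightarrow> p (\<theta> g v) = \<tau> g *v p v"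
  using symmetric by (simp add: symmetric_framework_def)

lemma tau_mult: "\<lbrakk>g \<in> carrier \<Gamma>; h \<in> carrier \<Gamma>\<rbrakk> \<Longrightarrow> \<tau> (g \<otimes> h) = \<tau> g ** \<tau> h"
  using hom_mult[OF tau_hom] by (simp add: orthogonal_grp_def)

lemma tau_orthogonal: "g \<in> carrier \<Gamma> \<Longrightarrow> orthogonal_matrix (\<tau> g)"
  using tau_hom by (auto simp: hom_def orthogonal_grp_def)

text \<open>The matrix \<open>\<tau> \<one>\<close> is idempotent, and an idempotent with a right
  inverse is the identity.\<close>

lemma tau_one: "\<tau> \<one> = mat 1"
proof -
  have "\<tau> \<one> ** \<tau> \<one> = \<tau> \<one>" by (simp flip: tau_mult)
  then have "\<tau> \<one> ** (\<tau> \<one> ** matrix_inv (\<tau> \<one>)) = \<tau> \<one> ** matrix_inv (\<tau> \<one>)"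
    by (simp add: matrix_mul_assoc)
  then show ?thesis by (simp add: orthogonal_matrix_inv_right tau_orthogonal)
qed

text \<open>If \<open>g\<close> and \<open>h\<close> agree at \<open>v\<close>, then
  \<open>inv h \<otimes> g\<close> fixes \<open>v\<close> and is trivial by freeness. Hence each
  vertex determines the group element that carries its representative to it.\<close>

lemma theta_cancel:
  assumes "g \<in> carrier \<Gamma>" "h \<in> carrier \<Gamma>" "v \<in> V" "\<theta> g v = \<theta> h v"
  shows "g = h"
proof -
  have "\<theta> (inv h \<otimes> g) v = \<theta> (inv h) (\<theta> h v)"
    using assms by (simp add: composition_rule)
  then have "\<theta> (inv h \<otimes> g) v = v"
    using orbit_sym_aux[OF assms(2,3) refl] by simp
  then have "inv h \<otimes> g = \<one>"
    using free assms by (auto simp: free_action_def)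
  then show ?thesis
    using assms by (metis inv_closed inv_equality inv_inv)
qed

section \<open>Vertex orbits and their representatives\<close>

lemma rep_mem: "X \<in> vertex_orbits \<Gamma> V \<theta> \<Longrightarrow> rep X \<in> X"
  using gain by (simp add: quotient_gain_graph_def)

lemma orbit_in_V: "X \<in> vertex_orbits \<Gamma> V \<theta> \<Longrightarrow> X \<subseteq> V"
  using orbits_coverture by (auto simp: vertex_orbits_def)

lemma orbit_mem: "v \<in> V \<Longrightarrow> orbit \<Gamma> \<theta> v \<in> vertex_orbits \<Gamma> V \<theta>"
  by (auto simp: vertex_orbits_def orbits_def)

lemma orbit_eq:
  assumes "X \<in> vertex_orbits \<Gamma> V \<theta>" "v \<in> X"
  shows "orbit \<Gamma> \<theta> v = X"
proof -
  have v: "v \<in> V" using assms orbit_in_V by blast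
  then show ?thesis
    using disjoint_union[of "orbit \<Gamma> \<theta> v" X] orbit_mem[OF v] orbit_refl[OF v] assms
    by (auto simp: vertex_orbits_def)
qed

lemma rep_V: "X \<in> vertex_orbits \<Gamma> V \<theta> \<Longrightarrow> rep X \<in> V"
  using rep_mem orbit_in_V by blast

lemma finite_vertex_orbits: "finite (vertex_orbits \<Gamma> V \<theta>)"
  using orbit_in_V finite_V by (meson PowI finite_Pow_iff finite_subset subsetI)

section \<open>Representative edges and the rows of the orbit matrix\<close>

definition edge_rep :: "'v set set \<Rightarrow> 'v set"
  where "edge_rep e = {rep (src e), \<theta> (\<psi> e) (rep (tgt e))}"

context
  fixes e assumes e: "e \<in> edge_orbits \<Gamma> E \<theta>"
begin

lemma src_orbit: "src e \<in> vertex_orbits \<Gamma> V \<theta>"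
  and tgt_orbit: "tgt e \<in> vertex_orbits \<Gamma> V \<theta>"
  and psi_carrier: "\<psi> e \<in> carrier \<Gamma>"
  using gain e by (auto simp: quotient_gain_graph_def)

text \<open>Since \<open>\<theta> (g \<otimes> \<psi> e)\<close> is a composition, the set that
  defines the gain is the orbit of its member at \<open>g = \<one>\<close>, which is
  \<open>edge_rep e\<close>.\<close>

lemma edge_orbit_eq: "e = {edge_action \<theta> g (edge_rep e) | g. g \<in> carrier \<Gamma>}"
proof -
  have "e = {{\<theta> g (rep (src e)), \<theta> (g \<otimes> \<psi> e) (rep (tgt e))} | g. g \<in> carrier \<Gamma>}"
    using gain e unfolding quotient_gain_graph_def by blast
  also have "\<dots> = {edge_action \<theta> g (edge_rep e) | g. g \<in> carrier \<Gamma>}"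
    unfolding Setcompr_eq_image
    by (intro image_cong refl)
      (auto simp: edge_action_def edge_rep_def composition_rule[OF rep_V[OF tgt_orbit] _ psi_carrier])
  finally show ?thesis .
qed

lemma edge_rep_ends_V: "rep (src e) \<in> V" "\<theta> (\<psi> e) (rep (tgt e)) \<in> V"
  using rep_V src_orbit tgt_orbit element_image[OF psi_carrier] by auto

lemma edge_rep_E: "edge_rep e \<in> E"
proof -
  have "e \<subseteq> E"
  proof
    fix x assume "x \<in> e"
    obtain f where f: "f \<in> E" "e = orbit \<Gamma> (edge_action \<theta>) f"
      using e by (auto simp: edge_orbits_def orbits_def)
    with \<open>x \<in> e\<close> obtain g where g: "g \<in> carrier \<Gamma>" "x = edge_action \<theta> g f"
      by (auto simp: orbit_def)
    obtain u v where uv: "f = {u, v}" "u \<in> V" "v \<in> V"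
      using graph f(1) by (fastforce simp: simple_graph_def card_2_iff)
    have "\<theta> g \<in> carrier (graph_aut_group V E)"
      using theta_hom g(1) by (auto simp: hom_def)
    then have "{\<theta> g u, \<theta> g v} \<in> E"
      using uv f(1) by (auto simp: graph_aut_group_def)
    then show "x \<in> E" by (simp add: g(2) edge_action_def uv(1))
  qed
  moreover have "edge_action \<theta> \<one> (edge_rep e) = edge_rep e"
    using edge_rep_ends_V by (simp add: edge_action_def edge_rep_def theta_one)
  then have "edge_rep e \<in> e"
    using edge_orbit_eq by (metis (mono_tags, lifting) mem_Collect_eq one_closed)
  ultimately show ?thesis by blast
qed

text \<open>This also covers loops of the quotient, where both ends lie in one vertex orbit: edges
  of \<open>G\<close> have exactly two elements.\<close>

lemma edge_rep_ends_ne: "rep (src e) \<noteq> \<theta> (\<psi> e) (rep (tgt e))"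
  using edge_rep_E graph by (auto simp: simple_graph_def edge_rep_def)

text \<open>At the end \<open>h v\<close> of the edge both the difference of points and the motion
  carry a factor \<open>\<tau> h\<close>. Orthogonality cancels the two factors and leaves the
  scalar \<open>cnj (\<rho> h)\<close>. Conjugation turns it into the \<open>\<rho> h\<close> of the
  orbit matrix and leaves the real points unchanged.\<close>

lemma rigidity_map_edge_rep:
  assumes m: "m \<in> isotypic_motions \<Gamma> V \<theta> \<tau> \<rho>"
  shows "cnj (rigidity_map V E p m (edge_rep e))
    = (\<Sum>(X, a)\<in>vertex_orbits \<Gamma> V \<theta> \<times> UNIV. cnj (m (rep X) $ a)
        * orbit_rigidity_matrix \<tau> \<rho> src tgt \<psi> (quotient_points rep p) e (X, a))"
proof -
  let ?u = "rep (src e)" and ?v = "rep (tgt e)" and ?h = "\<psi> e"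
  \<comment> \<open>Up to the factor \<open>\<rho> ?h\<close> on \<open>b\<close>, these are the two
    vectors in the row of \<open>e\<close> of the orbit matrix.\<close>
  define a b where "a = p ?u - \<tau> ?h *v p ?v" and "b = p ?v - matrix_inv (\<tau> ?h) *v p ?u"
  note orth = tau_orthogonal[OF psi_carrier]
  have v: "?v \<in> V" using rep_V tgt_orbit .
  have mv: "m (\<theta> ?h ?v) = cnj (\<rho> ?h) *s (map_matrix of_real (\<tau> ?h) *v m ?v)"
    using m psi_carrier v by (auto simp: isotypic_motions_def)
  have ph: "p (\<theta> ?h ?v) - p ?u = \<tau> ?h *v b"
    by (simp add: b_def p_theta[OF psi_carrier v] matrix_vector_mult_diff_distrib
        matrix_vector_mul_assoc orthogonal_matrix_inv_right[OF orth])
  have pu: "p ?u - p (\<theta> ?h ?v) = a"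
    by (simp only: a_def p_theta[OF psi_carrier v])
  have "(\<Sum>i\<in>UNIV. of_real ((p (\<theta> ?h ?v) - p ?u) $ i) * m (\<theta> ?h ?v) $ i)
      = cnj (\<rho> ?h) * (\<Sum>i\<in>UNIV. of_real ((\<tau> ?h *v b) $ i) * (map_matrix of_real (\<tau> ?h) *v m ?v) $ i)"
    unfolding mv ph vector_smult_component sum_distrib_left
    by (intro sum.cong refl) (simp only: mult_ac)
  then have "rigidity_map V E p m (edge_rep e)
      = (\<Sum>i\<in>UNIV. of_real (a $ i) * m ?u $ i) + cnj (\<rho> ?h) * (\<Sum>i\<in>UNIV. of_real (b $ i) * m ?v $ i)"
    using rigidity_map_edge[OF finite_V edge_rep_ends_ne edge_rep_ends_V edge_rep_E[unfolded edge_rep_def],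
        where p = p and m = m]
    by (simp only: edge_rep_def pu orthogonal_dot_complex[OF orth])
  then have lhs: "cnj (rigidity_map V E p m (edge_rep e))
      = (\<Sum>i\<in>UNIV. of_real (a $ i) * cnj (m ?u $ i)) + \<rho> ?h * (\<Sum>i\<in>UNIV. of_real (b $ i) * cnj (m ?v $ i))"
    by simp
  have entry: "orbit_rigidity_matrix \<tau> \<rho> src tgt \<psi> (quotient_points rep p) e (X, i)
      = (if X = src e then of_real (a $ i) else 0) + (if X = tgt e then \<rho> ?h * of_real (b $ i) else 0)" for X i
    by (simp only: orbit_rigidity_matrix_def quotient_points_def a_def b_def split)
  have "(\<Sum>i\<in>UNIV. cnj (m (rep X) $ i)
        * ((if X = src e then of_real (a $ i) else 0) + (if X = tgt e then \<rho> ?h * of_real (b $ i) else 0)))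
      = (if X = src e then \<Sum>i\<in>UNIV. of_real (a $ i) * cnj (m ?u $ i) else 0)
        + (if X = tgt e then \<rho> ?h * (\<Sum>i\<in>UNIV. of_real (b $ i) * cnj (m ?v $ i)) else 0)" for X
    \<comment> \<open>The case in which both equations hold is the loop, where the two contributions
      add up in one column.\<close>
    by (cases "X = src e"; cases "X = tgt e")
      (simp_all add: distrib_left sum.distrib sum_distrib_left mult_ac)
  then show ?thesis
    unfolding sum.cartesian_product[symmetric] entry lhs
    using finite_vertex_orbits src_orbit tgt_orbit by (simp add: sum.distrib)
qed

end

text \<open>Values on the representatives are transported along the orbits by the twisted action
  \<open>cnj (\<rho> \<gamma>) \<tau>(\<gamma>)\<close> on complex vectors. Freeness makes the
  transporting element unique, so the result is equivariant.\<close>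

lemma isotypic_motion_extension:
  fixes c :: "'v set \<Rightarrow> complex ^ 'd"
  obtains m where "m \<in> isotypic_motions \<Gamma> V \<theta> \<tau> \<rho>"
    and "\<And>X. X \<in> vertex_orbits \<Gamma> V \<theta> \<Longrightarrow> m (rep X) = c X"
proof -
  let ?X = "\<lambda>v. orbit \<Gamma> \<theta> v"
  have "\<exists>g. g \<in> carrier \<Gamma> \<and> \<theta> g (rep (?X v)) = v" if "v \<in> V" for v
  proof -
    have X: "?X v \<in> vertex_orbits \<Gamma> V \<theta>" using that by (rule orbit_mem)
    have "v \<in> ?X (rep (?X v))"
      using orbit_refl[OF that] by (simp only: orbit_eq[OF X rep_mem[OF X]])
    then show ?thesis unfolding orbit_def[of \<Gamma> \<theta> "rep (?X v)"] by auto
  qed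
  \<comment> \<open>Chooses for each vertex \<open>v\<close> the element \<open>g v\<close> that
    carries the representative of its orbit to \<open>v\<close>.\<close>
  then have "\<exists>g. \<forall>v\<in>V. g v \<in> carrier \<Gamma> \<and> \<theta> (g v) (rep (?X v)) = v"
    by (intro bchoice ballI)
  then obtain g where "\<forall>v\<in>V. g v \<in> carrier \<Gamma> \<and> \<theta> (g v) (rep (?X v)) = v"
    by (rule exE)
  then have g: "\<And>v. v \<in> V \<Longrightarrow> g v \<in> carrier \<Gamma>"
    and gv: "\<And>v. v \<in> V \<Longrightarrow> \<theta> (g v) (rep (?X v)) = v"
    by blast+
  define f where "f \<gamma> x = cnj (\<rho> \<gamma>) *s (map_matrix of_real (\<tau> \<gamma>) *v x)" for \<gamma> and x :: "complex ^ 'd"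
  define m where "m v = (if v \<in> V then f (g v) (c (?X v)) else 0)" for v
  have f_mult: "f (a \<otimes> b) x = f a (f b x)" if "a \<in> carrier \<Gamma>" "b \<in> carrier \<Gamma>" for a b x
    unfolding f_def rho_mult[OF that] tau_mult[OF that] map_matrix_of_real_mult complex_cnj_mult
    by (simp only: vector_scalar_commute matrix_vector_mul_assoc vector_smult_assoc)
  have "m (\<theta> \<gamma> v) = f \<gamma> (m v)" if "\<gamma> \<in> carrier \<Gamma>" "v \<in> V" for \<gamma> v
  proof -
    have w: "\<theta> \<gamma> v \<in> V" using that element_image by blast
    have "\<theta> \<gamma> v \<in> ?X v" using that by (auto simp: orbit_def)
    then have X: "?X (\<theta> \<gamma> v) = ?X v"
      by (rule orbit_eq[OF orbit_mem[OF that(2)]])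
    have r: "rep (?X v) \<in> V" using rep_V orbit_mem that by blast
    have "\<theta> (g (\<theta> \<gamma> v)) (rep (?X v)) = \<theta> \<gamma> v" using gv[OF w] X by simp
    also have "\<dots> = \<theta> (\<gamma> \<otimes> g v) (rep (?X v))"
      using gv[OF that(2)] composition_rule[OF r that(1) g[OF that(2)]] by simp
    \<comment> \<open>Both elements carry the representative to the same vertex. This identity and
      \<open>f_mult\<close> give equivariance of \<open>m\<close>.\<close>
    finally have "g (\<theta> \<gamma> v) = \<gamma> \<otimes> g v"
      using theta_cancel g w that r by blast
    then show ?thesis using that w by (simp add: m_def X f_mult g)
  qed
  then have "m \<in> isotypic_motions \<Gamma> V \<theta> \<tau> \<rho>"
    by (auto simp: isotypic_motions_def f_def m_def)
  moreover have "m (rep X) = c X" if X: "X \<in> vertex_orbits \<Gamma> V \<theta>" for X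
  proof -
    have r: "rep X \<in> V" "?X (rep X) = X" using rep_V[OF X] orbit_eq[OF X rep_mem[OF X]] by blast+
    have "\<theta> (g (rep X)) (rep X) = \<theta> \<one> (rep X)" using gv[OF r(1)] r theta_one by simp
    then have "g (rep X) = \<one>" using theta_cancel g r by blast
    then show ?thesis
      using r by (simp add: m_def f_def rho_one tau_one map_matrix_of_real_one)
  qed
  ultimately show ?thesis by (rule that)
qed

section \<open>Comparison of the image of the block with the column space\<close>

theorem map_rank_eq_matrix_rank:
  "map_rank (isotypic_motions \<Gamma> V \<theta> \<tau> \<rho>) (block_rigidity_map \<Gamma> V E \<theta> \<tau> \<rho> p)
    = matrix_rank (edge_orbits \<Gamma> E \<theta>) (vertex_orbits \<Gamma> V \<theta> \<times> UNIV)
        (orbit_rigidity_matrix \<tau> \<rho> src tgt \<psi> (quotient_points rep p))"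
proof -
  let ?J = "isotypic_motions \<Gamma> V \<theta> \<tau> \<rho>" and ?O = "edge_orbits \<Gamma> E \<theta>"
  let ?C = "vertex_orbits \<Gamma> V \<theta> \<times> (UNIV :: 'd set)"
  let ?M = "orbit_rigidity_matrix \<tau> \<rho> src tgt \<psi> (quotient_points rep p)"
  define I where "I = rigidity_map V E p ` ?J"
  define W where "W = matrix_col ?O ?M ` ?C"
  \<comment> \<open>Reads off a stress on the representative edges. The conjugation matches
    \<open>rigidity_map_edge_rep\<close>, so that images of motions land in the column space of the
    orbit matrix itself.\<close>
  define restr where "restr w = (\<lambda>e. if e \<in> ?O then cnj (w (edge_rep e)) else 0)"
    for w :: "'v set \<Rightarrow> complex"
  \<comment> \<open>The implication stands below the quantifiers so that \<open>g\<close> and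
    \<open>orb\<close> can be chosen as total functions of \<open>f\<close>.\<close>
  have "\<exists>g o'. f \<in> E \<longrightarrow> g \<in> carrier \<Gamma> \<and> o' \<in> ?O \<and> f = edge_action \<theta> g (edge_rep o')" for f
  proof (cases "f \<in> E")
    case True
    let ?o = "orbit \<Gamma> (edge_action \<theta>) f"
    have o: "?o \<in> ?O" using True by (auto simp: edge_orbits_def orbits_def)
    have "f \<subseteq> V" using True graph by (simp add: simple_graph_def)
    then have "edge_action \<theta> \<one> f = f" by (force simp: edge_action_def theta_one)
    then have "f \<in> ?o" unfolding orbit_def by (metis (mono_tags, lifting) mem_Collect_eq one_closed)
    then have "f \<in> {edge_action \<theta> g (edge_rep ?o) | g. g \<in> carrier \<Gamma>}"
      using edge_orbit_eq[OF o] by blast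
    then show ?thesis using o by blast
  qed simp
  then obtain g orb where g: "\<And>f. f \<in> E \<Longrightarrow> g f \<in> carrier \<Gamma>"
    and orb: "\<And>f. f \<in> E \<Longrightarrow> orb f \<in> ?O" "\<And>f. f \<in> E \<Longrightarrow> f = edge_action \<theta> (g f) (edge_rep (orb f))"
    by metis
  \<comment> \<open>Rebuilds a stress from its coordinates by isotypy: \<open>f\<close> is the
    translate by \<open>g f\<close> of the representative edge of \<open>orb f\<close>. The inner
    \<open>cnj\<close> undoes the one in \<open>restr\<close>.\<close>
  define ext where "ext y = (\<lambda>f. if f \<in> E then cnj (\<rho> (g f)) * cnj (y (orb f)) else 0)"
    for y :: "'v set set \<Rightarrow> complex"
  have "finite ?C" using finite_vertex_orbits by simp
  then have W: "finite W" by (simp add: W_def)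
  have "restr (rigidity_map V E p m)
      = (\<lambda>e. if e \<in> ?O then \<Sum>c\<in>?C. (case c of (X, a) \<Rightarrow> cnj (m (rep X) $ a)) * ?M e c else 0)"
    if "m \<in> ?J" for m
    using rigidity_map_edge_rep[OF _ that]
    by (auto simp: restr_def fun_eq_iff case_prod_unfold)
  note restr_motion = this
  have restr_I: "restr ` I = cfun.span W"
  proof
    show "restr ` I \<subseteq> cfun.span W"
      using restr_motion by (auto simp: I_def W_def span_matrix_col[OF \<open>finite ?C\<close>])
  next
    show "cfun.span W \<subseteq> restr ` I"
    proof
      fix y assume "y \<in> cfun.span W"
      then obtain x where y: "y = (\<lambda>e. if e \<in> ?O then \<Sum>c\<in>?C. x c * ?M e c else 0)"
        by (auto simp: W_def span_matrix_col[OF \<open>finite ?C\<close>])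
      \<comment> \<open>The coefficients in \<open>restr_motion\<close> are conjugates of the values
        of the motion, so the motion is prescribed by the conjugates of \<open>x\<close>.\<close>
      obtain m where m: "m \<in> ?J" "\<And>X. X \<in> vertex_orbits \<Gamma> V \<theta> \<Longrightarrow> m (rep X) = (\<chi> a. cnj (x (X, a)))"
        using isotypic_motion_extension[of "\<lambda>X. \<chi> a. cnj (x (X, a))"] by blast
      have "restr (rigidity_map V E p m) = y"
        unfolding restr_motion[OF m(1)] y
        by (intro ext if_cong sum.cong refl) (auto simp: m(2))
      then show "y \<in> restr ` I" using m(1) by (auto simp: I_def)
    qed
  qed
  \<comment> \<open>An element of \<open>I\<close> is an isotypic stress by
    \<open>rigidity_map_isotypic\<close>, hence fixed by its values on the representative
    edges.\<close>
  have "ext (restr w) = w" if "w \<in> I" for w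
  proof
    fix f
    have w: "w \<in> isotypic_stresses \<Gamma> E \<theta> \<rho>"
      using that rigidity_map_isotypic[OF theta_hom tau_hom symmetric] by (auto simp: I_def)
    show "ext (restr w) f = w f"
    proof (cases "f \<in> E")
      case True
      have "w (edge_action \<theta> (g f) (edge_rep (orb f))) = cnj (\<rho> (g f)) * w (edge_rep (orb f))"
        using w g[OF True] edge_rep_E[OF orb(1)[OF True]] by (simp add: isotypic_stresses_def)
      then show ?thesis using True orb by (simp add: ext_def restr_def flip: orb(2)[OF True])
    next
      case False
      then show ?thesis using w by (simp add: ext_def isotypic_stresses_def)
    qed
  qed
  then have "ext ` restr ` I = I" by (simp add: image_image)
  then have ext_W: "ext ` cfun.span W = I" by (simp add: restr_I)
  have ext_add: "ext (x + y) = ext x + ext y" for x y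
    by (auto simp: ext_def fun_eq_iff distrib_left)
  have ext_scale: "ext (scale_fun c x) = scale_fun (cnj c) (ext x)" for c x
    by (auto simp: ext_def fun_eq_iff scale_fun_def)
  \<comment> \<open>\<open>ext\<close> maps the column space onto \<open>I\<close> and
    \<open>restr\<close> maps \<open>I\<close> onto the column space. Both are conjugate-linear, so
    each gives one inequality of dimensions.\<close>
  have "cfun.dim I \<le> cfun.dim (cfun.span W)"
    using dim_semilinear_image_le[of ext cnj "cfun.span W" W] W
    by (simp add: ext_add ext_scale ext_W del: cfun.dim_span)
  moreover have "cfun.dim (restr ` I) \<le> cfun.dim I"
  proof (rule dim_semilinear_image_le[where f = restr and \<sigma> = cnj and W = "ext ` W"])
    show "restr (x + y) = restr x + restr y" for x y
      by (auto simp: restr_def fun_eq_iff)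
    show "restr (scale_fun c x) = scale_fun (cnj c) (restr x)" for c x
      by (auto simp: restr_def fun_eq_iff scale_fun_def)
    \<comment> \<open>Supplies the finite spanning set for \<open>I\<close> that the dimension bound
      asks for.\<close>
    show "I \<subseteq> cfun.span (ext ` W)"
      unfolding ext_W[symmetric] by (rule image_span_semilinear[of ext cnj, OF ext_add ext_scale])
    show "finite (ext ` W)" using W by simp
  qed
  ultimately have "cfun.dim I = cfun.dim W" by (simp add: restr_I)
  moreover have "block_rigidity_map \<Gamma> V E \<theta> \<tau> \<rho> p ` ?J = I"
    by (simp add: block_rigidity_map_def I_def)
  ultimately show ?thesis by (simp add: map_rank_def matrix_rank_def W_def)
qed

end

section \<open>Specialization to products of cyclic groups and their characters\<close>

theorem proposition4p2:
  fixes l :: nat and k :: "nat \<Rightarrow> nat"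
    and V :: "'v set" and E :: "'v set set"
    and \<theta> :: "(nat \<Rightarrow> int) \<Rightarrow> 'v \<Rightarrow> 'v"
    and \<tau> :: "(nat \<Rightarrow> int) \<Rightarrow> real ^ 'd ^ 'd"
    and p :: "'v \<Rightarrow> real ^ 'd"
    and rep :: "'v set \<Rightarrow> 'v"
    and src tgt :: "'v set set \<Rightarrow> 'v set"
    and \<psi> :: "'v set set \<Rightarrow> nat \<Rightarrow> int"
    and j :: "nat \<Rightarrow> int"
  assumes "\<forall>t \<in> {1..l}. k t > 0"
    and "simple_graph V E"
    and "\<theta> \<in> hom (cyclic_product l k) (graph_aut_group V E)"
    and "free_action (cyclic_product l k) V \<theta>"
    and "free_action (cyclic_product l k) E (edge_action \<theta>)"
    and "\<tau> \<in> hom (cyclic_product l k) orthogonal_grp"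
    and "symmetric_framework (cyclic_product l k) V E \<theta> \<tau> p"
    and "quotient_gain_graph (cyclic_product l k) V E \<theta> rep src tgt \<psi>"
    and "j \<in> carrier (cyclic_product l k)"
  shows "map_rank (isotypic_motions (cyclic_product l k) V \<theta> \<tau> (character l k j))
           (block_rigidity_map (cyclic_product l k) V E \<theta> \<tau> (character l k j) p)
       = matrix_rank (edge_orbits (cyclic_product l k) E \<theta>)
           (vertex_orbits (cyclic_product l k) V \<theta> \<times> UNIV)
           (orbit_rigidity_matrix \<tau> (character l k j) src tgt \<psi> (quotient_points rep p))"
proof -
  interpret symmetric_gain_framework "cyclic_product l k" V \<theta> E \<tau> p rep src tgt \<psi> "character l k j"
  proof (intro symmetric_gain_framework.intro group_action.intro symmetric_gain_framework_axioms.intro)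
    show "group_hom (cyclic_product l k) (BijGroup V) \<theta>"
      using assms(3)
      by (simp add: group_hom_def group_hom_axioms_def group_cyclic_product group_BijGroup
          hom_BijGroup_if_hom_graph_aut_group)
  qed (use assms in \<open>simp_all add: character_one character_mult\<close>)
  show ?thesis by (rule map_rank_eq_matrix_rank)
qed

end
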